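(* Let $\mathfrak P$ be the parasol graph and let $\mathfrak P+B'$ be the graph obtained from it by adding the vertex $B'$ (both defined in the context). Then: (i) $\mathfrak P\notin D_\infty$. (ii) $\mathfrak P+B'$ is $0$-dismantlable to $\mathfrak P$. (iii) $\mathfrak P+B'$ is $1$-dismantlable to $(\mathfrak P+B')-B_1$, and $(\mathfrak P+B')-B_1$ is $1$-dismantlable to a point.
   Context: All graphs are finite, undirected, without loops or multiple edges, with at least one vertex. For a graph $X$ and a vertex $x$, $N_X(x)$ is the set of neighbours of $x$, identified with the subgraph of $X$ it induces, $N_X[x]=N_X(x)\cup\{x\}$, and $X-x$ is the subgraph induced by $V(X)\setminus\{x\}$. A graph $X$ is a cone if it has a vertex $x$ with $N_X[x]=V(X)$; the one-vertex graph (a point) is a cone. Let $D_{-1}$ be the class of cones. Inductively, for an integer $k\ge 0$: a vertex $x$ of $X$ is $k$-dismantlable if $N_X(x)$ is non-empty and the graph $N_X(x)$ belongs to $D_{k-1}$; a graph $X$ is $k$-dismantlable to an induced subgraph $Y$ if $Y$ is obtained from $X$ by successively deleting vertices, each being $k$-dismantlable in the current graph; $D_k$ is the class of graphs that are $k$-dismantlable to a single vertex. $D_\infty=\bigcup_{k\ge 0}D_k$. The parasol graph $\mathfrak P$ has the $15$ vertices $I$, $A_1,\dots,A_7$, $B_1,\dots,B_7$ and, with indices of the $A$'s and $B$'s taken modulo $7$ in $\{1,\dots,7\}$, exactly the following edges for all $i$: $I\sim A_i$; $A_i\sim A_{i+1}$; $A_i\sim B_i$ and $A_i\sim B_{i+1}$;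 $B_i\sim B_{i+1}$; $B_i\sim B_{i+2}$. (In particular $N_{\mathfrak P}(I)$ is a $7$-cycle, each $N_{\mathfrak P}(A_i)$ is a $5$-cycle, and each $N_{\mathfrak P}(B_i)$ is a $4$-cycle with two disjoint pendant edges attached to two consecutive vertices of the cycle.) The graph $\mathfrak P+B'$ is obtained from $\mathfrak P$ by adding one new vertex $B'$ adjacent to $B_1$ and to all neighbours of $B_1$ in $\mathfrak P$ except $B_3$ and $B_6$. *)

theory Defs
  imports "Graph_Theory.Digraph_Component" "HOL-Library.Numeral_Type"
begin

text \<open>
  Finite simple undirected graphs are the symmetric, loop-free digraphs without parallel arcs of
  locale \<^locale>\<open>graph\<close>. The notions below are stated for arbitrary digraphs, but are only meant
  (and only used) for non-empty digraphs in that locale.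
\<close>

definition nbhd :: "('a, 'b) pre_digraph \<Rightarrow> 'a \<Rightarrow> 'a set" where
  "nbhd X x = {y \<in> verts X. x \<rightarrow>\<^bsub>X\<^esub> y}"

definition cone :: "('a, 'b) pre_digraph \<Rightarrow> bool" where
  "cone X \<longleftrightarrow> (\<exists>x \<in> verts X. insert x (nbhd X x) = verts X)"

definition is_point :: "('a, 'b) pre_digraph \<Rightarrow> bool" where
  "is_point X \<longleftrightarrow> (\<exists>x. verts X = {x})"

definition dismantlable_vertex_via ::
    "('a, 'b) pre_digraph set \<Rightarrow> ('a, 'b) pre_digraph \<Rightarrow> 'a \<Rightarrow> bool" where
  "dismantlable_vertex_via \<C> X x \<longleftrightarrow>
     x \<in> verts X \<and> nbhd X x \<noteq> {} \<and> X \<restriction> nbhd X x \<in> \<C>"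

definition dismantlable_to_via ::
    "('a, 'b) pre_digraph set \<Rightarrow> ('a, 'b) pre_digraph \<Rightarrow> ('a, 'b) pre_digraph \<Rightarrow> bool" where
  "dismantlable_to_via \<C> =
     (\<lambda>X Y. \<exists>x. dismantlable_vertex_via \<C> X x \<and> Y = pre_digraph.del_vert X x)\<^sup>*\<^sup>*"

text \<open>
  The index is shifted by one: \<open>D_pred k\<close> is the class $D_{k-1}$, so that \<open>D_pred 0\<close> is the class
  $D_{-1}$ of cones. The unshifted notions follow, and \<open>dismantlable_vertex_0\<close> to \<open>D_class_conv\<close>
  confirm the usual mutually recursive description of them.
\<close>

primrec D_pred :: "nat \<Rightarrow> ('a, 'b) pre_digraph set" where
  "D_pred 0 = {X. cone X}"
| "D_pred (Suc k) = {X. \<exists>Y. dismantlable_to_via (D_pred k) X Y \<and> is_point Y}"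

definition dismantlable_vertex :: "nat \<Rightarrow> ('a, 'b) pre_digraph \<Rightarrow> 'a \<Rightarrow> bool" where
  "dismantlable_vertex k = dismantlable_vertex_via (D_pred k)"

definition dismantlable_to ::
    "nat \<Rightarrow> ('a, 'b) pre_digraph \<Rightarrow> ('a, 'b) pre_digraph \<Rightarrow> bool" where
  "dismantlable_to k = dismantlable_to_via (D_pred k)"

definition D_class :: "nat \<Rightarrow> ('a, 'b) pre_digraph set" where
  "D_class k = D_pred (Suc k)"

definition D_inf :: "('a, 'b) pre_digraph set" where
  "D_inf = (\<Union>k. D_class k)"

lemma dismantlable_vertex_0:
  "dismantlable_vertex 0 X x \<longleftrightarrow> x \<in> verts X \<and> nbhd X x \<noteq> {} \<and> cone (X \<restriction> nbhd X x)"
  by (simp add: dismantlable_vertex_def dismantlable_vertex_via_def)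

lemma dismantlable_vertex_Suc:
  "dismantlable_vertex (Suc k) X x \<longleftrightarrow> x \<in> verts X \<and> nbhd X x \<noteq> {} \<and> X \<restriction> nbhd X x \<in> D_class k"
  by (simp add: dismantlable_vertex_def dismantlable_vertex_via_def D_class_def)

lemma dismantlable_to_conv:
  "dismantlable_to k =
     (\<lambda>X Y. \<exists>x. dismantlable_vertex k X x \<and> Y = pre_digraph.del_vert X x)\<^sup>*\<^sup>*"
  by (simp add: dismantlable_to_def dismantlable_to_via_def dismantlable_vertex_def)

lemma D_class_conv: "D_class k = {X. \<exists>Y. dismantlable_to k X Y \<and> is_point Y}"
  by (simp add: D_class_def dismantlable_to_def)

text \<open>
  The indices live in the ring \<^typ>\<open>7\<close> of integers modulo 7, in which the numeral 7 equals 0.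
  The vertex \<open>vB'\<close> does not belong to the parasol graph itself.
\<close>

datatype vertex = vI | vA 7 | vB 7 | vB'

definition parasol_edges :: "(vertex \<times> vertex) set" where
  "parasol_edges = (\<Union>i. {(vI, vA i), (vA i, vA (i + 1)), (vA i, vB i), (vA i, vB (i + 1)),
                          (vB i, vB (i + 1)), (vB i, vB (i + 2))})"

definition parasol :: "(vertex, vertex \<times> vertex) pre_digraph" where
  "parasol = with_proj \<lparr>pverts = {vI} \<union> range vA \<union> range vB,
                         parcs = parasol_edges \<union> parasol_edges\<inverse>\<rparr>"

definition parasol_plus :: "(vertex, vertex \<times> vertex) pre_digraph" where
  "parasol_plus =
     (let N = {vB 1} \<union> (nbhd parasol (vB 1) - {vB 3, vB 6})
      in with_proj \<lparr>pverts = insert vB' (verts parasol),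
                    parcs = arcs parasol \<union> {vB'} \<times> N \<union> N \<times> {vB'}\<rparr>)"

lemma graph_parasol: "graph parasol"
  unfolding parasol_def
  by (intro pair_graph.pair_graphD_graph, unfold_locales)
     (auto simp: parasol_edges_def symmetric_def sym_def)

lemma nbhd_parasol:
  "nbhd parasol vI = range vA"
  "nbhd parasol (vA i) = {vI, vA (i - 1), vB i, vB (i + 1), vA (i + 1)}"
  "nbhd parasol (vB i) = {vA i, vA (i - 1), vB (i - 1), vB (i + 1), vB (i - 2), vB (i + 2)}"
  by (auto simp: nbhd_def parasol_def parasol_edges_def)

lemma parasol_plus_conv:
  "parasol_plus =
     with_proj \<lparr>pverts = insert vB' ({vI} \<union> range vA \<union> range vB),
                parcs = parasol_edges \<union> parasol_edges\<inverse>
                  \<union> {vB'} \<times> {vB 1, vA 1, vA 7, vB 2, vB 7} \<union> {vB 1, vA 1, vA 7, vB 2, vB 7} \<times> {vB'}\<rparr>"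
proof -
  have "{vB 1} \<union> (nbhd parasol (vB 1) - {vB 3, vB 6}) = {vB 1, vA 1, vA 7, vB 2, vB 7}"
    unfolding nbhd_parasol by auto
  then show ?thesis
    by (simp only: parasol_plus_def Let_def) (simp only: parasol_def with_proj_simps pair_pre_digraph.simps)
qed

lemma graph_parasol_plus: "graph parasol_plus"
  unfolding parasol_plus_conv
  by (intro pair_graph.pair_graphD_graph, unfold_locales)
     (auto simp: parasol_edges_def symmetric_def sym_def)

lemma nbhd_parasol_plus: "nbhd parasol_plus vB' = {vB 1, vA 1, vA 7, vB 2, vB 7}"
  by (auto simp: nbhd_def parasol_plus_conv parasol_edges_def)

end

theory Submission
  imports Defs
begin

text \<open>
  The negative part rests on the fact that dismantling a triangle-free graph can only prune leaves.
  In such a graph every neighbourhood is arcless, and an arcless graph has no dismantlable vertex, so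
  it lies in some $D_k$ or in $D_{-1}$ only if it is a point; a dismantlable vertex therefore has
  exactly one neighbour. Pruning leaves never touches a set \<open>W\<close> of vertices each having two neighbours
  in \<open>W\<close>, for example the vertices of a cycle, so a triangle-free graph with such a set is in no
  class $D_k$ (\<open>triangle_free_leafless_notin_D_pred\<close>). In the parasol graph every neighbourhood is
  of this kind: a 7-cycle, a 5-cycle, or a 4-cycle with two pendant edges. No vertex of the parasol is
  dismantlable for any \<open>k\<close>, and the parasol is not a point.

  For the positive parts, $B'$ is dominated by $B_1$ and can be removed at once, which leaves the
  parasol. In the presence of $B'$ the 4-cycle in the neighbourhood of $B_1$ becomes a cone with apex
  $B'$; pruning the two pendant vertices and then the cone makes that neighbourhood a member of $D_0$,
  so $B_1$ is 1-dismantlable. After the deletion of $B_1$ the neighbourhood of $B_2$ is the path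
  $B_4, B_3, A_2, A_1, B', B_7$, so $B_2$ is 1-dismantlable as well. What remains can be consumed one
  dominated vertex at a time, going around the parasol in the order of the indices. The longer
  domination arguments are certified by lists of pairs (deleted vertex, dominating vertex)
  that \<open>elimination\<close> checks against the neighbourhoods.
\<close>

section \<open>Neighbourhoods in induced subgraphs\<close>

lemma nbhd_subset_verts: "nbhd X x \<subseteq> verts X"
  by (auto simp: nbhd_def)

lemma nbhd_induce:
  "x \<in> S \<Longrightarrow> S \<subseteq> verts X \<Longrightarrow> nbhd (X \<restriction> S) x = nbhd X x \<inter> S"
  by (auto simp: nbhd_def arcs_ends_def arc_to_ends_def)

lemma nbhd_induce_outside: "x \<notin> S \<Longrightarrow> nbhd (X \<restriction> S) x = {}"
  by (auto simp: nbhd_def arcs_ends_def arc_to_ends_def)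

lemma nbhd_induce_symmetric:
  assumes "\<And>x y. y \<in> nbhd X x \<Longrightarrow> x \<in> nbhd X y" and "S \<subseteq> verts X" and "v \<in> nbhd (X \<restriction> S) u"
  shows "u \<in> nbhd (X \<restriction> S) v"
proof -
  have "u \<in> S" using assms(3) nbhd_induce_outside by fastforce
  moreover from this have "v \<in> S" "v \<in> nbhd X u"
    using assms(2,3) by (simp_all add: nbhd_induce)
  ultimately show ?thesis
    using assms(1,2) by (simp add: nbhd_induce)
qed

lemma induce_induce: "T \<subseteq> S \<Longrightarrow> (X \<restriction> S) \<restriction> T = X \<restriction> T"
  by (auto simp: induce_subgraph_def)

lemma induce_verts:
  assumes "wf_digraph X"
  shows "X \<restriction> verts X = X"
  using assms by (auto simp: induce_subgraph_def wf_digraph_def intro!: pre_digraph.equality)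

lemma del_vert_induce: "pre_digraph.del_vert (X \<restriction> S) x = X \<restriction> (S - {x})"
  by (auto simp: induce_subgraph_def pre_digraph.del_vert_def)

lemma nbhd_del_vert:
  "nbhd (pre_digraph.del_vert X x) y = (if y = x then {} else nbhd X y - {x})"
  by (auto simp: nbhd_def arcs_ends_def arc_to_ends_def pre_digraph.del_vert_def)

section \<open>Dismantling a triangle-free graph only prunes leaves\<close>

definition triangle_free :: "('a, 'b) pre_digraph \<Rightarrow> bool" where
  "triangle_free X \<longleftrightarrow> (\<forall>x y z. y \<in> nbhd X x \<longrightarrow> z \<in> nbhd X x \<longrightarrow> z \<notin> nbhd X y)"

text \<open>
  The set \<open>W\<close> is a witness for a non-trivial 2-core: in the subgraph induced by \<open>W\<close> no vertex is
  isolated or a leaf. Writing this as not being contained in any singleton avoids cardinalities.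
\<close>

definition leafless_in :: "('a, 'b) pre_digraph \<Rightarrow> 'a set \<Rightarrow> bool" where
  "leafless_in X W \<longleftrightarrow> W \<noteq> {} \<and> W \<subseteq> verts X \<and> (\<forall>w\<in>W. \<forall>c. \<not> nbhd X w \<inter> W \<subseteq> {c})"

lemma dismantlable_to_via_stuck:
  assumes "dismantlable_to_via \<C> X Y" and "\<And>x. \<not> dismantlable_vertex_via \<C> X x"
  shows "Y = X"
  using assms unfolding dismantlable_to_via_def
  by (cases rule: converse_rtranclpE) auto

lemma arcless_in_D_pred_is_point:
  assumes "X \<in> D_pred k" and arcless: "\<And>x. x \<in> verts X \<Longrightarrow> nbhd X x = {}"
  shows "is_point X"
proof (cases k)
  case 0
  then show ?thesis
    using assms by (fastforce simp: cone_def is_point_def)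
next
  case (Suc l)
  then show ?thesis
    using assms dismantlable_to_via_stuck[of "D_pred l" X]
    by (auto simp: dismantlable_vertex_via_def)
qed

text \<open>
  The neighbourhood of a vertex of a triangle-free graph is arcless, and it is a point if it
  belongs to $D_{-1}$ or to some $D_k$.
\<close>

lemma triangle_free_dismantlable_vertex_is_leaf:
  assumes tf: "triangle_free X" and "dismantlable_vertex_via (D_pred k) X x"
  obtains c where "nbhd X x = {c}"
proof -
  have "is_point (X \<restriction> nbhd X x)"
  proof (rule arcless_in_D_pred_is_point)
    show "X \<restriction> nbhd X x \<in> D_pred k"
      using assms(2) by (simp add: dismantlable_vertex_via_def)
    show "nbhd (X \<restriction> nbhd X x) y = {}" if "y \<in> verts (X \<restriction> nbhd X x)" for y
      using that tf by (auto simp: nbhd_induce nbhd_subset_verts triangle_free_def)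
  qed
  then show ?thesis
    using that by (auto simp: is_point_def)
qed

text \<open>
  A deleted vertex is a leaf of the current graph, so it lies outside \<open>W\<close>, and the
  arcs inside \<open>W\<close> are all kept.
\<close>

lemma leafless_in_dismantlable_to_via:
  assumes "dismantlable_to_via (D_pred k) X Y" and "triangle_free X" and "leafless_in X W"
  shows "triangle_free Y \<and> leafless_in Y W"
  using assms(1) unfolding dismantlable_to_via_def
proof (induction rule: rtranclp_induct)
  case base
  then show ?case using assms(2,3) by simp
next
  case (step Y Z)
  then obtain x where x: "dismantlable_vertex_via (D_pred k) Y x"
    and Z: "Z = pre_digraph.del_vert Y x" by auto
  obtain c where c: "nbhd Y x = {c}"
    using triangle_free_dismantlable_vertex_is_leaf[OF _ x] step.IH by auto
  have "x \<notin> W"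
    using c step.IH unfolding leafless_in_def by blast
  moreover from this have "nbhd Z w \<inter> W = nbhd Y w \<inter> W" if "w \<in> W" for w
    using that by (auto simp: Z nbhd_del_vert)
  ultimately have "leafless_in Z W"
    using step.IH by (simp add: leafless_in_def) (auto simp: Z pre_digraph.del_vert_def)
  moreover have "triangle_free Z"
    using step.IH by (auto simp: Z triangle_free_def nbhd_del_vert)
  ultimately show ?case by simp
qed

lemma leafless_in_not_point:
  assumes "leafless_in X W"
  shows "\<not> is_point X"
proof
  assume "is_point X"
  then obtain x where "verts X = {x}" by (auto simp: is_point_def)
  then show False
    using assms nbhd_subset_verts[of X x] unfolding leafless_in_def by blast
qed

text \<open>
  A triangle-free cone is a star: every vertex other than the apex has at most the apex as a
  neighbour. This excludes such vertices from \<open>W\<close>, but the apex alone has no neighbours in \<open>W\<close>.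
\<close>

lemma triangle_free_leafless_not_cone:
  assumes tf: "triangle_free X" and W: "leafless_in X W"
  shows "\<not> cone X"
proof
  assume "cone X"
  then obtain x where x: "insert x (nbhd X x) = verts X" by (auto simp: cone_def)
  have nbr: "nbhd X y \<subseteq> {x}" if "y \<in> nbhd X x" for y
    using that tf x nbhd_subset_verts[of X y] unfolding triangle_free_def by blast
  obtain w where w: "w \<in> W" "w \<in> nbhd X x"
  proof -
    obtain v where v: "v \<in> W" using W by (auto simp: leafless_in_def)
    show ?thesis
    proof (cases "v = x")
      case True
      then have "\<not> nbhd X x \<inter> W \<subseteq> {x}" using v W by (auto simp: leafless_in_def)
      then show ?thesis using that by auto
    next
      case False
      then have "v \<in> nbhd X x" using x v W by (auto simp: leafless_in_def)
      then show ?thesis using that v by auto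
    qed
  qed
  then show False using nbr[OF w(2)] W unfolding leafless_in_def by blast
qed

lemma triangle_free_leafless_notin_D_pred:
  assumes "triangle_free X" and "leafless_in X W"
  shows "X \<notin> D_pred k"
proof (cases k)
  case 0
  then show ?thesis using triangle_free_leafless_not_cone[OF assms] by simp
next
  case (Suc l)
  then show ?thesis
    using leafless_in_dismantlable_to_via[OF _ assms] leafless_in_not_point by auto
qed

text \<open>
  The next two criteria phrase both properties through the neighbourhoods in the ambient graph, in
  a form that rewriting can decide once these neighbourhoods are listed.
\<close>

lemma triangle_free_induce:
  assumes "S \<subseteq> verts X"
    and "\<And>x y. x \<in> S \<Longrightarrow> y \<in> nbhd X x \<inter> S \<Longrightarrow> nbhd X y \<inter> (nbhd X x \<inter> S) = {}"
  shows "triangle_free (X \<restriction> S)"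
  unfolding triangle_free_def
proof (intro allI impI)
  fix x y z assume yz: "y \<in> nbhd (X \<restriction> S) x" "z \<in> nbhd (X \<restriction> S) x"
  then have "x \<in> S" using nbhd_induce_outside[of x S X] by auto
  then have "y \<in> nbhd X x \<inter> S" "z \<in> nbhd X x \<inter> S" using yz assms(1) by (simp_all add: nbhd_induce)
  then show "z \<notin> nbhd (X \<restriction> S) y" using assms(2)[OF \<open>x \<in> S\<close>] assms(1) by (auto simp: nbhd_induce)
qed

lemma leafless_in_induce:
  assumes "S \<subseteq> verts X" "W \<subseteq> S" "W \<noteq> {}"
    and "\<forall>w\<in>W. \<exists>u\<in>nbhd X w. u \<in> W \<and> (\<exists>v\<in>nbhd X w. v \<in> W \<and> u \<noteq> v)"
  shows "leafless_in (X \<restriction> S) W"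
  unfolding leafless_in_def
proof (intro conjI ballI allI)
  fix w c assume "w \<in> W"
  then have "nbhd (X \<restriction> S) w = nbhd X w \<inter> S" using assms(1,2) by (intro nbhd_induce) auto
  moreover obtain u v where "u \<in> nbhd X w" "u \<in> W" "v \<in> nbhd X w" "v \<in> W" and "u \<noteq> v"
    using bspec[OF assms(4) \<open>w \<in> W\<close>] by blast
  ultimately have "u \<in> nbhd (X \<restriction> S) w \<inter> W" "v \<in> nbhd (X \<restriction> S) w \<inter> W"
    using assms(2) by auto
  then show "\<not> nbhd (X \<restriction> S) w \<inter> W \<subseteq> {c}" using \<open>u \<noteq> v\<close> by blast
qed (use assms in auto)

section \<open>The parasol graph has no dismantlable vertex\<close>

lemma verts_parasol: "verts parasol = {vI} \<union> range vA \<union> range vB"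
  by (simp add: parasol_def)

text \<open>
  Sums of an index and a numeral are compared by cancelling the index and reducing the numerals
  modulo 7. Differences would escape this, hence the non-negative offsets.
\<close>

lemma nbhd_parasol_offsets:
  "nbhd parasol (vA i) = {vI, vA (i + 6), vB i, vB (i + 1), vA (i + 1)}"
  "nbhd parasol (vB i) = {vA i, vA (i + 6), vB (i + 6), vB (i + 1), vB (i + 5), vB (i + 2)}"
proof -
  have "i - 1 = i + (6 :: 7)" "i - 2 = i + (5 :: 7)"
    by (simp_all add: diff_eq_eq add.assoc)
  then show
    "nbhd parasol (vA i) = {vI, vA (i + 6), vB i, vB (i + 1), vA (i + 1)}"
    "nbhd parasol (vB i) = {vA i, vA (i + 6), vB (i + 6), vB (i + 1), vB (i + 5), vB (i + 2)}"
    by (simp_all only: nbhd_parasol)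
qed

text \<open>
  The cyclic symmetry of the parasol leaves three neighbourhoods to inspect. The indices \<open>i\<close> stay
  symbolic, since only their differences matter.
\<close>

lemma triangle_free_nbhd_vI: "triangle_free (parasol \<restriction> nbhd parasol vI)"
  by (rule triangle_free_induce[OF nbhd_subset_verts])
    (auto simp: nbhd_parasol(1) nbhd_parasol_offsets add.assoc)

lemma triangle_free_nbhd_vA: "triangle_free (parasol \<restriction> nbhd parasol (vA i))"
  by (rule triangle_free_induce[OF nbhd_subset_verts])
    (auto simp: nbhd_parasol(1) nbhd_parasol_offsets add.assoc)

lemma triangle_free_nbhd_vB: "triangle_free (parasol \<restriction> nbhd parasol (vB i))"
  by (rule triangle_free_induce[OF nbhd_subset_verts])
    (auto simp: nbhd_parasol(1) nbhd_parasol_offsets add.assoc)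

lemma leafless_in_nbhd_vI: "leafless_in (parasol \<restriction> nbhd parasol vI) (range vA)"
  by (rule leafless_in_induce[OF nbhd_subset_verts])
   (auto simp: nbhd_parasol(1) nbhd_parasol_offsets add.assoc)

lemma leafless_in_nbhd_vA: "leafless_in (parasol \<restriction> nbhd parasol (vA i)) (nbhd parasol (vA i))"
  by (rule leafless_in_induce[OF nbhd_subset_verts])
   (simp_all add: nbhd_parasol(1) nbhd_parasol_offsets add.assoc
     ex_disj_distrib conj_disj_distribR)

text \<open>
  The four vertices form the cycle of the neighbourhood; $B_{i-2}$ and $B_{i+2}$ hang
  on it as pendant vertices.
\<close>

lemma leafless_in_nbhd_vB:
  "leafless_in (parasol \<restriction> nbhd parasol (vB i)) {vA i, vA (i + 6), vB (i + 6), vB (i + 1)}"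
  by (rule leafless_in_induce[OF nbhd_subset_verts])
   (simp_all add: nbhd_parasol(1) nbhd_parasol_offsets add.assoc
     ex_disj_distrib conj_disj_distribR)

lemma parasol_not_in_D_inf: "parasol \<notin> D_inf"
proof
  assume "parasol \<in> D_inf"
  then obtain k Y where Y: "dismantlable_to_via (D_pred k) parasol Y" "is_point Y"
    by (auto simp: D_inf_def D_class_def)
  have "parasol \<restriction> nbhd parasol x \<notin> D_pred k" if "x \<in> verts parasol" for x
  proof -
    obtain W where "leafless_in (parasol \<restriction> nbhd parasol x) W"
      using \<open>x \<in> verts parasol\<close> leafless_in_nbhd_vI leafless_in_nbhd_vA leafless_in_nbhd_vB
      by (auto simp: verts_parasol)
    moreover have "triangle_free (parasol \<restriction> nbhd parasol x)"
      using \<open>x \<in> verts parasol\<close> triangle_free_nbhd_vI triangle_free_nbhd_vA triangle_free_nbhd_vB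
      by (auto simp: verts_parasol)
    ultimately show ?thesis
      by (rule triangle_free_leafless_notin_D_pred[rotated])
  qed
  then have "Y = parasol"
    using dismantlable_to_via_stuck[OF Y(1)] by (auto simp: dismantlable_vertex_via_def)
  with Y(2) obtain x where "verts parasol = {x}" by (auto simp: is_point_def)
  moreover have "vI \<in> verts parasol" "vA 0 \<in> verts parasol" by (auto simp: verts_parasol)
  ultimately show False by auto
qed

section \<open>Eliminating dominated vertices\<close>

text \<open>
  The list \<open>ps\<close> is a certificate for a 0-dismantling to the vertex \<open>a\<close>: its pairs \<open>(x, c)\<close> give the
  vertices in the order of their deletion, each with a vertex \<open>c\<close> that is still present and
  dominates \<open>x\<close>, so that \<open>c\<close> is an apex of the current neighbourhood of \<open>x\<close>. The current vertex set is
  read off from the rest of the list, which makes the check a plain computation.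
\<close>

fun elimination :: "('a, 'b) pre_digraph \<Rightarrow> 'a \<Rightarrow> ('a \<times> 'a) list \<Rightarrow> bool" where
  "elimination X a [] \<longleftrightarrow> True"
| "elimination X a ((x, c) # ps) \<longleftrightarrow>
     (let R = insert a (set (map fst ps))
      in x \<notin> R \<and> c \<in> R \<and> c \<in> nbhd X x \<and>
         nbhd X x \<inter> insert x R \<subseteq> insert c (nbhd X c) \<and> elimination X a ps)"

lemma dismantlable_to_refl: "dismantlable_to k X X"
  by (simp add: dismantlable_to_conv)

lemma dismantlable_to_step:
  assumes "dismantlable_vertex k X x" "dismantlable_to k (pre_digraph.del_vert X x) Y"
  shows "dismantlable_to k X Y"
  unfolding dismantlable_to_conv
proof (rule converse_rtranclp_into_rtranclp)
  show "\<exists>y. dismantlable_vertex k X y \<and> pre_digraph.del_vert X x = pre_digraph.del_vert X y"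
    using assms(1) by blast
qed (rule assms(2)[unfolded dismantlable_to_conv])

lemma dominated_dismantlable_vertex:
  assumes S: "S \<subseteq> verts X" "x \<in> S"
    and c: "c \<in> S" "c \<in> nbhd X x" "nbhd X x \<inter> S \<subseteq> insert c (nbhd X c)"
  shows "dismantlable_vertex 0 (X \<restriction> S) x"
proof -
  have N: "nbhd (X \<restriction> S) x = nbhd X x \<inter> S" using S by (intro nbhd_induce)
  have "insert c (nbhd (X \<restriction> (nbhd X x \<inter> S)) c) = nbhd X x \<inter> S"
    using S c by (subst nbhd_induce) auto
  then have "cone (X \<restriction> (nbhd X x \<inter> S))"
    using c unfolding cone_def by auto
  then show ?thesis
    using S c by (auto simp: dismantlable_vertex_0 N induce_induce)
qed

lemma elimination_dismantlable_to:
  assumes "elimination X a ps" "insert a (set (map fst ps)) \<subseteq> verts X"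
  shows "dismantlable_to 0 (X \<restriction> insert a (set (map fst ps))) (X \<restriction> {a})"
  using assms
proof (induction ps)
  case Nil
  then show ?case by (simp add: dismantlable_to_refl)
next
  case (Cons p ps)
  obtain x c where p: "p = (x, c)" by (cases p)
  define R where "R = insert a (set (map fst ps))"
  have step: "x \<notin> R" "c \<in> R" "c \<in> nbhd X x" "nbhd X x \<inter> insert x R \<subseteq> insert c (nbhd X c)"
      "elimination X a ps"
    using Cons.prems(1) by (simp_all only: p elimination.simps Let_def R_def simp_thms)
  have S: "insert a (set (map fst (p # ps))) = insert x R"
    by (auto simp: p R_def)
  have verts: "insert x R \<subseteq> verts X" using Cons.prems(2) unfolding S .
  have "dismantlable_vertex 0 (X \<restriction> insert x R) x"
    using step verts by (intro dominated_dismantlable_vertex[where c = c]) auto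
  moreover have "dismantlable_to 0 (pre_digraph.del_vert (X \<restriction> insert x R) x) (X \<restriction> {a})"
    using Cons.IH step verts by (simp add: del_vert_induce R_def)
  ultimately show ?case unfolding S by (rule dismantlable_to_step)
qed

lemma elimination_in_D_0:
  assumes "elimination X a ps" "insert a (set (map fst ps)) \<subseteq> verts X"
  shows "X \<restriction> insert a (set (map fst ps)) \<in> D_class 0"
  using elimination_dismantlable_to[OF assms] by (auto simp: D_class_conv is_point_def)

lemma elimination_dismantlable_vertex_1:
  assumes "elimination X a ps" and S: "S \<subseteq> verts X" "x \<in> S"
    and N: "nbhd X x \<inter> S = insert a (set (map fst ps))"
  shows "dismantlable_vertex 1 (X \<restriction> S) x"
proof -
  have "nbhd (X \<restriction> S) x = insert a (set (map fst ps))"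
    using N nbhd_induce[OF S(2,1)] by simp
  moreover have "insert a (set (map fst ps)) \<subseteq> S" using N by auto
  ultimately show ?thesis
    using S elimination_in_D_0[OF assms(1)]
    by (simp add: dismantlable_vertex_Suc flip: One_nat_def)
       (auto simp: dismantlable_vertex_Suc induce_induce)
qed

text \<open>
  In a cone the vertices other than the apex can be deleted in any order, as the apex
  dominates all of them.
\<close>

lemma cone_in_D_0:
  assumes fin: "finite (verts X)" and "wf_digraph X"
    and sym: "\<And>x y. y \<in> nbhd X x \<Longrightarrow> x \<in> nbhd X y" and "cone X"
  shows "X \<in> D_class 0"
proof -
  obtain a where a: "a \<in> verts X" "insert a (nbhd X a) = verts X"
    using \<open>cone X\<close> by (auto simp: cone_def)
  obtain xs where xs: "set xs = verts X - {a}" "distinct xs"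
    using fin finite_distinct_list by blast
  have "elimination X a (map (\<lambda>x. (x, a)) ys)"
    if "distinct ys" "set ys \<subseteq> verts X - {a}" for ys
    using that
  proof (induction ys)
    case (Cons y ys)
    have "y \<in> nbhd X a" using Cons.prems a by auto
    then have "a \<in> nbhd X y" by (rule sym)
    then show ?case
      using Cons a nbhd_subset_verts[of X y] by (auto simp: Let_def)
  qed simp
  from elimination_in_D_0[OF this[OF xs(2)]] a xs(1)
  have "X \<restriction> insert a (set xs) \<in> D_class 0"
    by (auto simp: o_def)
  moreover have "insert a (set xs) = verts X" using a xs by auto
  ultimately show ?thesis using induce_verts[OF \<open>wf_digraph X\<close>] by simp
qed

text \<open>
  This is the inclusion of $D_{-1}$ in $D_0$ applied to the neighbourhoods of the deleted vertices.
  Finiteness and symmetry are inherited by the graphs that occur on the way.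
\<close>

lemma dismantlable_to_0_imp_1:
  assumes "dismantlable_to 0 X Y" and "finite (verts X)"
    and "\<And>x y. y \<in> nbhd X x \<Longrightarrow> x \<in> nbhd X y"
  shows "dismantlable_to 1 X Y"
  using assms unfolding dismantlable_to_conv[of 0]
proof (induction rule: converse_rtranclp_induct)
  case base
  then show ?case by (simp add: dismantlable_to_refl)
next
  case (step X Z)
  then obtain x where x: "dismantlable_vertex 0 X x" and Z: "Z = pre_digraph.del_vert X x"
    by auto
  let ?N = "nbhd X x"
  have "X \<restriction> ?N \<in> D_class 0"
  proof (rule cone_in_D_0)
    show "finite (verts (X \<restriction> ?N))"
      using step.prems(1) finite_subset[OF nbhd_subset_verts] by auto
    show "wf_digraph (X \<restriction> ?N)" by (auto simp: wf_digraph_def)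
    show "cone (X \<restriction> ?N)" using x by (simp add: dismantlable_vertex_0)
    show "u \<in> nbhd (X \<restriction> ?N) v" if "v \<in> nbhd (X \<restriction> ?N) u" for u v
      using step.prems(2) nbhd_subset_verts that by (rule nbhd_induce_symmetric)
  qed
  then have "dismantlable_vertex 1 X x"
    using x by (auto simp: dismantlable_vertex_0 dismantlable_vertex_Suc)
  moreover have "dismantlable_to 1 Z Y"
  proof (rule step.IH)
    show "finite (verts Z)" using step.prems(1) by (simp add: Z pre_digraph.del_vert_def)
    show "u \<in> nbhd Z v" if "v \<in> nbhd Z u" for u v
      using that step.prems(2) by (auto simp: Z nbhd_del_vert split: if_splits)
  qed
  ultimately show ?case unfolding Z by (rule dismantlable_to_step)
qed

section \<open>Dismantling the extended parasol graph\<close>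

lemma UNIV_7: "(UNIV :: 7 set) = {1, 2, 3, 4, 5, 6, 7}"
proof -
  have "card {1, 2, 3, 4, 5, 6, 7 :: 7} = CARD(7)" by simp
  then show ?thesis by (metis card_subset_eq finite subset_UNIV)
qed

lemma range_7: "range f = {f 1, f 2, f 3, f 4, f 5, f 6, f 7}" for f :: "7 \<Rightarrow> 'a"
  by (simp only: UNIV_7 image_insert image_empty)

lemma verts_parasol_plus: "verts parasol_plus = insert vB' (verts parasol)"
  by (simp add: parasol_plus_def Let_def)

lemma nbhd_parasol_plus_vI: "nbhd parasol_plus vI = range vA"
  by (auto simp: nbhd_def parasol_plus_conv parasol_edges_def)

lemma nbhd_parasol_plus_vA:
  "nbhd parasol_plus (vA i) = nbhd parasol (vA i) \<union> (if i = 1 \<or> i = 7 then {vB'} else {})"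
  by (auto simp: nbhd_def parasol_plus_conv parasol_def parasol_edges_def)

lemma nbhd_parasol_plus_vB:
  "nbhd parasol_plus (vB i) = nbhd parasol (vB i) \<union> (if i = 1 \<or> i = 2 \<or> i = 7 then {vB'} else {})"
  by (auto simp: nbhd_def parasol_plus_conv parasol_def parasol_edges_def)

lemmas nbhds_parasol_plus =
  nbhd_parasol_plus nbhd_parasol_plus_vI nbhd_parasol_plus_vA nbhd_parasol_plus_vB
  nbhd_parasol_offsets

lemma induce_verts_parasol_plus: "parasol_plus \<restriction> verts parasol_plus = parasol_plus"
proof -
  interpret graph parasol_plus by (rule graph_parasol_plus)
  show ?thesis by (rule induce_verts) unfold_locales
qed

lemma nbhd_parasol_plus_symmetric:
  assumes "y \<in> nbhd parasol_plus x"
  shows "x \<in> nbhd parasol_plus y"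
proof -
  interpret graph parasol_plus by (rule graph_parasol_plus)
  show ?thesis
    using assms by (auto simp: nbhd_def intro: graph_symmetric)
qed

lemma vB'_dominated: "dismantlable_vertex 0 parasol_plus vB'"
  by (rule dominated_dismantlable_vertex[of "verts parasol_plus" parasol_plus vB' "vB 1",
        unfolded induce_verts_parasol_plus])
    (simp_all add: verts_parasol_plus verts_parasol nbhds_parasol_plus)

lemma del_vert_vB': "pre_digraph.del_vert parasol_plus vB' = parasol"
proof (rule pre_digraph.equality)
  have "parasol_edges \<subseteq> (- {vB'}) \<times> (- {vB'})"
    by (auto simp: parasol_edges_def)
  then show "arcs (pre_digraph.del_vert parasol_plus vB') = arcs parasol"
    by (auto simp: parasol_plus_conv parasol_def pre_digraph.del_vert_def)
qed (auto simp: parasol_plus_conv parasol_def pre_digraph.del_vert_def)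

text \<open>
  The vertices $B_6$ and $B_3$ are pendant in the neighbourhood of $B_1$; those of the
  4-cycle $A_1, A_7, B_7, B_2$ are dominated by $B'$.
\<close>

lemma vB_1_dismantlable: "dismantlable_vertex 1 parasol_plus (vB 1)"
proof (rule elimination_dismantlable_vertex_1[of parasol_plus vB' _ "verts parasol_plus",
      unfolded induce_verts_parasol_plus])
  show "elimination parasol_plus vB'
    [(vB 6, vB 7), (vB 3, vB 2), (vA 1, vB'), (vA 7, vB'), (vB 2, vB'), (vB 7, vB')]"
    by (simp add: nbhds_parasol_plus)
qed (auto simp: verts_parasol_plus verts_parasol nbhds_parasol_plus)

text \<open>
  Without $B_1$ the neighbourhood of $B_2$ is a path, which is pruned from the end $B_4$
  towards the end $B_7$.
\<close>

lemma vB_2_dismantlable: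
  "dismantlable_vertex 1 (parasol_plus \<restriction> (verts parasol_plus - {vB 1})) (vB 2)"
proof (rule elimination_dismantlable_vertex_1)
  show "elimination parasol_plus (vB 7)
    [(vB 4, vB 3), (vB 3, vA 2), (vA 2, vA 1), (vA 1, vB'), (vB', vB 7)]"
    by (simp add: nbhds_parasol_plus)
qed (auto simp: verts_parasol_plus verts_parasol nbhds_parasol_plus)

text \<open>
  With $B_1$ and $B_2$ gone, $B'$ keeps only $A_1$, $A_7$ and $B_7$ as neighbours, hence is dominated
  by $A_7$, and then $A_1$ by $I$. This opens the ring of the $A_i$, and the deletions run along it:
  $A_i$ is dominated by $A_{i+1}$, and $B_i$ by $B_{i+1}$, until the end of the ring is reached.
\<close>

lemma remainder_dismantlable:
  "dismantlable_to 0 (parasol_plus \<restriction> (verts parasol_plus - {vB 1} - {vB 2})) (parasol_plus \<restriction> {vI})"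
proof -
  let ?ps = "[(vB', vA 7), (vA 1, vI), (vA 2, vA 3), (vB 3, vB 4), (vA 3, vA 4), (vB 4, vB 5),
    (vA 4, vA 5), (vB 5, vB 6), (vA 5, vA 6), (vB 6, vB 7), (vA 6, vA 7), (vB 7, vA 7), (vA 7, vI)]"
  have elim: "elimination parasol_plus vI ?ps"
    by (simp add: nbhds_parasol_plus)
  have V: "verts parasol_plus - {vB 1} - {vB 2} = insert vI (set (map fst ?ps))"
    unfolding verts_parasol_plus verts_parasol range_7
    by (rule equalityI) (simp_all add: insert_Diff_if)
  have "insert vI (set (map fst ?ps)) \<subseteq> verts parasol_plus"
    unfolding V[symmetric] by blast
  with elim show ?thesis
    unfolding V by (rule elimination_dismantlable_to)
qed

theorem proposition18:
  shows "parasol \<notin> D_inf \<and>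
    dismantlable_to 0 parasol_plus parasol \<and>
    dismantlable_to 1 parasol_plus (pre_digraph.del_vert parasol_plus (vB 1)) \<and>
    (\<exists>Y. dismantlable_to 1 (pre_digraph.del_vert parasol_plus (vB 1)) Y \<and> is_point Y)"
proof (intro conjI)
  show "parasol \<notin> D_inf" by (rule parasol_not_in_D_inf)
  show "dismantlable_to 0 parasol_plus parasol"
    using dismantlable_to_step[OF vB'_dominated dismantlable_to_refl] by (simp add: del_vert_vB')
  show "dismantlable_to 1 parasol_plus (pre_digraph.del_vert parasol_plus (vB 1))"
    using vB_1_dismantlable dismantlable_to_refl by (rule dismantlable_to_step)
  let ?V = "verts parasol_plus"
  have "dismantlable_to 1 (parasol_plus \<restriction> (?V - {vB 1} - {vB 2})) (parasol_plus \<restriction> {vI})"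
  proof (rule dismantlable_to_0_imp_1[OF remainder_dismantlable])
    show "finite (verts (parasol_plus \<restriction> (?V - {vB 1} - {vB 2})))"
      by (simp add: verts_parasol_plus verts_parasol)
    show "x \<in> nbhd (parasol_plus \<restriction> (?V - {vB 1} - {vB 2})) y"
      if "y \<in> nbhd (parasol_plus \<restriction> (?V - {vB 1} - {vB 2})) x" for x y
      using nbhd_parasol_plus_symmetric _ that by (rule nbhd_induce_symmetric) auto
  qed
  then have "dismantlable_to 1 (parasol_plus \<restriction> (?V - {vB 1})) (parasol_plus \<restriction> {vI})"
    by (intro dismantlable_to_step[OF vB_2_dismantlable]) (simp only: del_vert_induce)
  moreover have "pre_digraph.del_vert parasol_plus (vB 1) = parasol_plus \<restriction> (?V - {vB 1})"
    using del_vert_induce[of parasol_plus ?V] by (simp add: induce_verts_parasol_plus)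
  ultimately show "\<exists>Y. dismantlable_to 1 (pre_digraph.del_vert parasol_plus (vB 1)) Y \<and> is_point Y"
    by (intro exI[of _ "parasol_plus \<restriction> {vI}"]) (simp add: is_point_def)
qed

end
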